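(* Let $\mathbb{V}$ be a real vector space of dimension $d$ with $4\le d<8$, equipped with a euclidean inner product $\langle -,-\rangle$, and let $F\in\Lambda^4\mathbb{V}^*$. Then $[\iota_\Xi F, F]=0$ for all $\Xi\in\Lambda^2\mathbb{V}$ if and only if $F$ is simple.
   Context: Euclidean means positive-definite. For $\Xi\in\Lambda^{2}\mathbb{V}$, $\iota_\Xi F$ is the $2$-form obtained by contracting $F$ with $\Xi$; for $\Xi=X_1\wedge X_2$ it is $F(X_1,X_2,-,-)$. A $2$-form $\omega\in\Lambda^2\mathbb{V}^*\cong\mathfrak{so}(\mathbb{V})$ acts on forms $\Omega\in\Lambda\mathbb{V}^*$ by $[\omega,\Omega]$, defined for $\omega=\alpha\wedge\beta$ with $\alpha,\beta\in\mathbb{V}^*$ by $$[\alpha\wedge\beta,\Omega]=\alpha\wedge\iota_{\beta^\sharp}\Omega-\beta\wedge\iota_{\alpha^\sharp}\Omega$$ and extended linearly in $\omega$, where $\alpha^\sharp\in\mathbb{V}$ is the vector dual to $\alpha$ under the inner product. A $p$-form is simple if it can be written as a wedge product of $p$ one-forms (in particular the zero form is simple). *)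

theory Defs
  imports "HOL-Analysis.Analysis"
begin

text \<open>
  Multilinear functions of \<open>p\<close> arguments are functions on lists that vanish on
  lists of length other than \<open>p\<close>.  For a finite-dimensional space \<open>'v\<close>, the set
  \<open>forms p\<close> over \<open>'v\<close> is the exterior power of the dual space.  The dual of a
  Euclidean space \<open>'a\<close> is the type \<open>'a \<Rightarrow>\<^sub>L real\<close> (every linear functional is bounded),
  so \<open>forms p\<close> over \<open>'a \<Rightarrow>\<^sub>L real\<close> is the exterior power of \<open>'a\<close> itself, a vector \<open>X\<close>
  being identified with evaluation at \<open>X\<close>.
\<close>

definition forms :: "nat \<Rightarrow> ('v::real_vector list \<Rightarrow> real) set" where
  "forms p = {\<Omega>.
     (\<forall>vs. length vs \<noteq> p \<longrightarrow> \<Omega> vs = 0) \<and>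
     (\<forall>vs i. length vs = p \<longrightarrow> i < p \<longrightarrow> linear (\<lambda>x. \<Omega> (vs[i := x]))) \<and>
     (\<forall>vs. length vs = p \<longrightarrow> \<not> distinct vs \<longrightarrow> \<Omega> vs = 0)}"

definition unit_form :: "'a list \<Rightarrow> real" where
  "unit_form vs = (if vs = [] then 1 else 0)"

definition wedge1 :: "('a::real_normed_vector \<Rightarrow>\<^sub>L real) \<Rightarrow> ('a list \<Rightarrow> real) \<Rightarrow> 'a list \<Rightarrow> real"
    (infixr \<open>\<and>\<^sub>1\<close> 70) where
  "(\<alpha> \<and>\<^sub>1 \<Omega>) vs =
     (\<Sum>i<length vs. (-1) ^ i * blinfun_apply \<alpha> (vs ! i) * \<Omega> (take i vs @ drop (Suc i) vs))"

definition wedge_list :: "('a::real_normed_vector \<Rightarrow>\<^sub>L real) list \<Rightarrow> 'a list \<Rightarrow> real" where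
  "wedge_list \<alpha>s = foldr (\<and>\<^sub>1) \<alpha>s unit_form"

definition simple_form :: "nat \<Rightarrow> ('a::real_normed_vector list \<Rightarrow> real) \<Rightarrow> bool" where
  "simple_form p \<Omega> \<longleftrightarrow> (\<exists>\<alpha>s. length \<alpha>s = p \<and> \<Omega> = wedge_list \<alpha>s)"

definition interior :: "'a \<Rightarrow> ('a list \<Rightarrow> real) \<Rightarrow> 'a list \<Rightarrow> real" where
  "interior X \<Omega> vs = \<Omega> (X # vs)"

abbreviation flat :: "'a::euclidean_space \<Rightarrow> 'a \<Rightarrow>\<^sub>L real" where
  "flat \<equiv> blinfun_inner_right"

definition sharp :: "('a::euclidean_space \<Rightarrow>\<^sub>L real) \<Rightarrow> 'a" where
  "sharp \<alpha> = (THE X. \<forall>v. X \<bullet> v = blinfun_apply \<alpha> v)"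

text \<open>
  The action of \<open>\<alpha> \<and> \<beta>\<close>, and its linear extension to all 2-forms
  \<open>\<omega> = 1/2 * (\<Sum>i j. \<omega>(e\<^sub>i, e\<^sub>j) e\<^sup>i \<and> e\<^sup>j)\<close>; see \<open>two_form_expansion\<close> and \<open>act_decomposable\<close>.
\<close>

definition act2 :: "('a::euclidean_space \<Rightarrow>\<^sub>L real) \<Rightarrow> ('a \<Rightarrow>\<^sub>L real) \<Rightarrow> ('a list \<Rightarrow> real)
    \<Rightarrow> 'a list \<Rightarrow> real" where
  "act2 \<alpha> \<beta> \<Omega> vs =
     (\<alpha> \<and>\<^sub>1 interior (sharp \<beta>) \<Omega>) vs - (\<beta> \<and>\<^sub>1 interior (sharp \<alpha>) \<Omega>) vs"

definition act :: "('a::euclidean_space list \<Rightarrow> real) \<Rightarrow> ('a list \<Rightarrow> real) \<Rightarrow> 'a list \<Rightarrow> real" where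
  "act \<omega> \<Omega> vs = 1/2 * (\<Sum>i\<in>Basis. \<Sum>j\<in>Basis. \<omega> [i, j] * act2 (flat i) (flat j) \<Omega> vs)"

definition wedge_vec :: "'a::real_normed_vector \<Rightarrow> 'a \<Rightarrow> ('a \<Rightarrow>\<^sub>L real) list \<Rightarrow> real" where
  "wedge_vec X Y \<alpha>s =
     (if length \<alpha>s = 2
      then blinfun_apply (\<alpha>s ! 0) X * blinfun_apply (\<alpha>s ! 1) Y
         - blinfun_apply (\<alpha>s ! 0) Y * blinfun_apply (\<alpha>s ! 1) X
      else 0)"

text \<open>
  The linear extension to all bivectors \<open>\<Xi> = 1/2 * (\<Sum>i j. \<Xi>(e\<^sup>i, e\<^sup>j) e\<^sub>i \<and> e\<^sub>j)\<close> of the contraction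
  with \<open>X \<and> Y\<close>, which is \<open>F(X, Y, -, \<dots>, -)\<close>; see \<open>bivector_expansion\<close> and \<open>contract_decomposable\<close>.
\<close>

definition contract :: "(('a::euclidean_space \<Rightarrow>\<^sub>L real) list \<Rightarrow> real) \<Rightarrow> ('a list \<Rightarrow> real)
    \<Rightarrow> 'a list \<Rightarrow> real" where
  "contract \<Xi> F vs = 1/2 * (\<Sum>i\<in>Basis. \<Sum>j\<in>Basis. \<Xi> [flat i, flat j] * F (i # j # vs))"


lemma sharp_inner: "sharp \<alpha> \<bullet> v = blinfun_apply \<alpha> v"
proof -
  have ex: "\<forall>v. (\<Sum>i\<in>Basis. blinfun_apply \<alpha> i *\<^sub>R i) \<bullet> v = blinfun_apply \<alpha> v"
  proof
    fix v :: 'a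
    have "blinfun_apply \<alpha> v = blinfun_apply \<alpha> (\<Sum>i\<in>Basis. (v \<bullet> i) *\<^sub>R i)"
      by (simp add: euclidean_representation)
    also have "\<dots> = (\<Sum>i\<in>Basis. (v \<bullet> i) * blinfun_apply \<alpha> i)"
      by (simp add: blinfun.sum_right blinfun.scaleR_right)
    also have "\<dots> = (\<Sum>i\<in>Basis. blinfun_apply \<alpha> i *\<^sub>R i) \<bullet> v"
      by (simp add: inner_sum_left inner_commute[of v] mult.commute)
    finally show "(\<Sum>i\<in>Basis. blinfun_apply \<alpha> i *\<^sub>R i) \<bullet> v = blinfun_apply \<alpha> v" ..
  qed
  have "\<exists>!X. \<forall>v. X \<bullet> v = blinfun_apply \<alpha> v"
  proof (rule ex1I)
    show "\<forall>v. (\<Sum>i\<in>Basis. blinfun_apply \<alpha> i *\<^sub>R i) \<bullet> v = blinfun_apply \<alpha> v" by (rule ex)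
    show "X = (\<Sum>i\<in>Basis. blinfun_apply \<alpha> i *\<^sub>R i)" if "\<forall>v. X \<bullet> v = blinfun_apply \<alpha> v" for X
      using that ex by (metis vector_eq_rdot)
  qed
  from theI'[OF this] show ?thesis by (simp add: sharp_def)
qed

lemma sharp_flat [simp]: "sharp (flat X) = X"
  by (metis sharp_inner blinfun_inner_right.rep_eq vector_eq_rdot)

lemma flat_sharp [simp]: "flat (sharp \<alpha>) = \<alpha>"
  by (rule blinfun_eqI) (simp add: sharp_inner)

lemma sharp_expand: "sharp \<alpha> = (\<Sum>i\<in>Basis. blinfun_apply \<alpha> i *\<^sub>R i)"
  by (metis (no_types, lifting) euclidean_representation sharp_inner sum.cong)

lemma covector_apply_expand:
  "blinfun_apply \<alpha> v = (\<Sum>i\<in>Basis. blinfun_apply \<alpha> i * (i \<bullet> v))"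
  by (subst sharp_inner[symmetric]) (simp only: sharp_expand inner_sum_left inner_scaleR_left)

lemma covector_expand: "\<alpha> = (\<Sum>i\<in>Basis. blinfun_apply \<alpha> i *\<^sub>R flat i)"
proof (rule blinfun_eqI)
  fix v
  show "blinfun_apply \<alpha> v = blinfun_apply (\<Sum>i\<in>Basis. blinfun_apply \<alpha> i *\<^sub>R flat i) v"
    by (subst covector_apply_expand) (simp add: blinfun.sum_left blinfun.scaleR_left)
qed

lemma forms_linear_Cons:
  assumes "\<Omega> \<in> forms p"
  shows "linear (\<lambda>x. \<Omega> (x # vs))"
proof (cases "length vs = p - 1 \<and> 0 < p")
  case True
  then have "length (0 # vs) = p" "0 < p" by auto
  then have "linear (\<lambda>x. \<Omega> ((0 # vs)[0 := x]))"
    using assms unfolding forms_def by blast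
  then show ?thesis by simp
next
  case False
  then have "\<Omega> (x # vs) = 0" for x
    using assms unfolding forms_def by auto
  then show ?thesis by (simp add: linear_zero)
qed

lemma forms_linear_Cons2:
  assumes "\<Omega> \<in> forms p"
  shows "linear (\<lambda>y. \<Omega> (x # y # vs))"
proof (cases "length vs = p - 2 \<and> 1 < p")
  case True
  then have "length (x # 0 # vs) = p" "1 < p" by auto
  then have "linear (\<lambda>y. \<Omega> ((x # 0 # vs)[1 := y]))"
    using assms unfolding forms_def by blast
  then show ?thesis by simp
next
  case False
  then have "\<Omega> (x # y # vs) = 0" for y
    using assms unfolding forms_def by auto
  then show ?thesis by (simp add: linear_zero)
qed

lemma forms_swap:
  assumes "\<Omega> \<in> forms p"
  shows "\<Omega> (y # x # vs) = - \<Omega> (x # y # vs)"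
proof -
  have z: "\<Omega> (u # u # vs) = 0" for u
    using assms unfolding forms_def by (cases "length (u # u # vs) = p") auto
  have "0 = \<Omega> ((x + y) # (x + y) # vs)" by (simp add: z)
  also have "\<dots> = \<Omega> (x # (x + y) # vs) + \<Omega> (y # (x + y) # vs)"
    by (rule linear_add[OF forms_linear_Cons[OF assms]])
  also have "\<dots> = \<Omega> (x # y # vs) + \<Omega> (y # x # vs)"
    by (simp add: linear_add[OF forms_linear_Cons2[OF assms]] z)
  finally show ?thesis by simp
qed

lemma forms_expand2:
  fixes \<Omega> :: "'a::real_vector list \<Rightarrow> real"
  assumes "\<Omega> \<in> forms p"
  shows "\<Omega> ((\<Sum>i\<in>A. f i *\<^sub>R u i) # (\<Sum>j\<in>B. g j *\<^sub>R w j) # vs) =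
    (\<Sum>i\<in>A. \<Sum>j\<in>B. f i * g j * \<Omega> (u i # w j # vs))"
proof -
  have "\<Omega> ((\<Sum>i\<in>A. f i *\<^sub>R u i) # (\<Sum>j\<in>B. g j *\<^sub>R w j) # vs) =
      (\<Sum>i\<in>A. f i * \<Omega> (u i # (\<Sum>j\<in>B. g j *\<^sub>R w j) # vs))"
    by (simp only: linear_sum[OF forms_linear_Cons[OF assms]]
        linear_cmul[OF forms_linear_Cons[OF assms]] real_scaleR_def)
  then show ?thesis
    by (simp add: linear_sum[OF forms_linear_Cons2[OF assms]]
        linear_cmul[OF forms_linear_Cons2[OF assms]] sum_distrib_left mult.assoc)
qed

lemma wedge_list_2:
  "wedge_list [\<alpha>, \<beta>] vs =
     (if length vs = 2
      then blinfun_apply \<alpha> (vs ! 0) * blinfun_apply \<beta> (vs ! 1)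
         - blinfun_apply \<alpha> (vs ! 1) * blinfun_apply \<beta> (vs ! 0)
      else 0)"
proof (cases "length vs = 2")
  case True
  then obtain x y where "vs = [x, y]" by (auto simp: length_Suc_conv numeral_2_eq_2)
  then show ?thesis
    by (simp add: wedge_list_def wedge1_def unit_form_def)
next
  case False
  have "(\<beta> \<and>\<^sub>1 unit_form) us = 0" if "length us \<noteq> 1" for us
    using that unfolding wedge1_def unit_form_def
    by (intro sum.neutral) (auto simp: not_less le_Suc_eq)
  moreover have "length (take i vs @ drop (Suc i) vs) \<noteq> 1" if "i < length vs" for i
    using that False by auto
  ultimately show ?thesis
    using False by (simp add: wedge_list_def wedge1_def[of \<alpha>])
qed

lemma two_form_expansion:
  fixes \<omega> :: "'a::euclidean_space list \<Rightarrow> real"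
  assumes "\<omega> \<in> forms 2"
  shows "\<omega> vs = 1/2 * (\<Sum>i\<in>Basis. \<Sum>j\<in>Basis. \<omega> [i, j] * wedge_list [flat i, flat j] vs)"
proof (cases "length vs = 2")
  case True
  then obtain x y where vs: "vs = [x, y]" by (auto simp: length_Suc_conv numeral_2_eq_2)
  have e: "\<omega> [x, y] = (\<Sum>i\<in>Basis. \<Sum>j\<in>Basis. (x \<bullet> i) * (y \<bullet> j) * \<omega> [i, j])" for x y
    using forms_expand2[OF assms, of "\<lambda>i. x \<bullet> i" "\<lambda>i. i" Basis "\<lambda>i. y \<bullet> i" "\<lambda>i. i" Basis "[]"]
    by (simp add: euclidean_representation)
  have "\<omega> [x, y] = 1/2 * (\<omega> [x, y] - \<omega> [y, x])"
    using forms_swap[OF assms, of y x "[]"] by simp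
  also have "\<dots> = 1/2 * (\<Sum>i\<in>Basis. \<Sum>j\<in>Basis. \<omega> [i, j] * wedge_list [flat i, flat j] [x, y])"
    unfolding e[of x y] e[of y x] sum_subtractf[symmetric]
    by (simp add: wedge_list_2 algebra_simps inner_commute)
  finally show ?thesis by (simp add: vs)
next
  case False
  then show ?thesis using assms by (simp add: forms_def wedge_list_2)
qed

lemma bivector_expansion:
  fixes \<Xi> :: "('a::euclidean_space \<Rightarrow>\<^sub>L real) list \<Rightarrow> real"
  assumes "\<Xi> \<in> forms 2"
  shows "\<Xi> \<alpha>s = 1/2 * (\<Sum>i\<in>Basis. \<Sum>j\<in>Basis. \<Xi> [flat i, flat j] * wedge_vec i j \<alpha>s)"
proof (cases "length \<alpha>s = 2")
  case True
  then obtain \<alpha> \<beta> where vs: "\<alpha>s = [\<alpha>, \<beta>]" by (auto simp: length_Suc_conv numeral_2_eq_2)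
  have e: "\<Xi> [\<alpha>, \<beta>] =
      (\<Sum>i\<in>Basis. \<Sum>j\<in>Basis. blinfun_apply \<alpha> i * blinfun_apply \<beta> j * \<Xi> [flat i, flat j])" for \<alpha> \<beta>
    using forms_expand2[OF assms, of "blinfun_apply \<alpha>" flat Basis "blinfun_apply \<beta>" flat Basis "[]"]
    by (simp add: covector_expand[symmetric])
  have "\<Xi> [\<alpha>, \<beta>] = 1/2 * (\<Xi> [\<alpha>, \<beta>] - \<Xi> [\<beta>, \<alpha>])"
    using forms_swap[OF assms, of \<beta> \<alpha> "[]"] by simp
  also have "\<dots> = 1/2 * (\<Sum>i\<in>Basis. \<Sum>j\<in>Basis. \<Xi> [flat i, flat j] * wedge_vec i j [\<alpha>, \<beta>])"
    unfolding e[of \<alpha> \<beta>] e[of \<beta> \<alpha>] sum_subtractf[symmetric]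
    by (simp add: wedge_vec_def algebra_simps)
  finally show ?thesis by (simp add: vs)
next
  case False
  then show ?thesis using assms by (simp add: forms_def wedge_vec_def)
qed

lemma contract_decomposable:
  fixes F :: "'a::euclidean_space list \<Rightarrow> real"
  assumes "F \<in> forms p"
  shows "contract (wedge_vec X Y) F vs = F (X # Y # vs)"
proof -
  have e: "F (x # y # vs) = (\<Sum>i\<in>Basis. \<Sum>j\<in>Basis. (x \<bullet> i) * (y \<bullet> j) * F (i # j # vs))" for x y
    using forms_expand2[OF assms, of "\<lambda>i. x \<bullet> i" "\<lambda>i. i" Basis "\<lambda>i. y \<bullet> i" "\<lambda>i. i" Basis vs]
    by (simp add: euclidean_representation)
  have "F (X # Y # vs) = 1/2 * (F (X # Y # vs) - F (Y # X # vs))"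
    using forms_swap[OF assms, of Y X vs] by simp
  also have "\<dots> = contract (wedge_vec X Y) F vs"
    unfolding e[of X Y] e[of Y X] sum_subtractf[symmetric] contract_def
    by (simp add: wedge_vec_def algebra_simps inner_commute)
  finally show ?thesis ..
qed

lemma contract_forms:
  fixes F :: "'a::euclidean_space list \<Rightarrow> real"
  assumes "F \<in> forms (p + 2)"
  shows "contract \<Xi> F \<in> forms p"
proof -
  have 1: "F (i # j # vs) = 0" if "length vs \<noteq> p" for i j vs
    using assms that unfolding forms_def by simp
  have 2: "linear (\<lambda>x. F (i # j # vs[k := x]))" if "length vs = p" "k < p" for i j vs k
  proof -
    have "length (i # j # vs) = p + 2" "k + 2 < p + 2" using that by auto
    then have "linear (\<lambda>x. F ((i # j # vs)[k + 2 := x]))"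
      using assms unfolding forms_def by blast
    then show ?thesis by simp
  qed
  have 3: "F (i # j # vs) = 0" if "length vs = p" "\<not> distinct vs" for i j vs
    using assms that unfolding forms_def by simp
  show ?thesis
    unfolding forms_def
  proof (intro CollectI conjI allI impI)
    fix vs :: "'a list" and k
    assume "length vs = p" "k < p"
    then show "linear (\<lambda>x. contract \<Xi> F (vs[k := x]))"
      unfolding contract_def
      by (intro linearI)
        (simp_all add: linear_add[OF 2] linear_cmul[OF 2] sum.distrib sum_distrib_left algebra_simps)
  qed (simp_all add: contract_def 1 3)
qed

lemma act2_bilinear:
  assumes "\<Omega> \<in> forms p"
  shows "act2 \<alpha> \<beta> \<Omega> vs =
    (\<Sum>i\<in>Basis. \<Sum>j\<in>Basis. blinfun_apply \<alpha> i * blinfun_apply \<beta> j * act2 (flat i) (flat j) \<Omega> vs)"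
proof -
  have w: "(\<alpha> \<and>\<^sub>1 interior (sharp \<beta>) \<Omega>) vs = (\<Sum>i\<in>Basis. \<Sum>j\<in>Basis.
      blinfun_apply \<alpha> i * blinfun_apply \<beta> j * (flat i \<and>\<^sub>1 interior j \<Omega>) vs)" for \<alpha> \<beta>
  proof -
    let ?d = "\<lambda>k. take k vs @ drop (Suc k) vs"
    have b: "\<Omega> (sharp \<beta> # us) = (\<Sum>j\<in>Basis. blinfun_apply \<beta> j * \<Omega> (j # us))" for us
      by (simp add: sharp_expand linear_sum[OF forms_linear_Cons[OF assms]]
          linear_cmul[OF forms_linear_Cons[OF assms]])
    have "(\<alpha> \<and>\<^sub>1 interior (sharp \<beta>) \<Omega>) vs = (\<Sum>k<length vs. \<Sum>i\<in>Basis. \<Sum>j\<in>Basis.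
        blinfun_apply \<alpha> i * blinfun_apply \<beta> j * ((-1) ^ k * (i \<bullet> (vs ! k)) * \<Omega> (j # ?d k)))"
      unfolding wedge1_def interior_def b
      by (subst covector_apply_expand) (simp add: sum_distrib_left sum_distrib_right ac_simps, intro sum.cong refl sum.swap)
    also have "\<dots> = (\<Sum>i\<in>Basis. \<Sum>k<length vs. \<Sum>j\<in>Basis.
        blinfun_apply \<alpha> i * blinfun_apply \<beta> j * ((-1) ^ k * (i \<bullet> (vs ! k)) * \<Omega> (j # ?d k)))"
      by (rule sum.swap)
    also have "\<dots> = (\<Sum>i\<in>Basis. \<Sum>j\<in>Basis. \<Sum>k<length vs.
        blinfun_apply \<alpha> i * blinfun_apply \<beta> j * ((-1) ^ k * (i \<bullet> (vs ! k)) * \<Omega> (j # ?d k)))"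
      by (intro sum.cong refl sum.swap)
    finally show ?thesis
      by (simp add: wedge1_def interior_def sum_distrib_left)
  qed
  have "(\<beta> \<and>\<^sub>1 interior (sharp \<alpha>) \<Omega>) vs = (\<Sum>i\<in>Basis. \<Sum>j\<in>Basis.
      blinfun_apply \<alpha> i * blinfun_apply \<beta> j * (flat j \<and>\<^sub>1 interior i \<Omega>) vs)"
    by (subst w, subst sum.swap) (simp add: mult.commute)
  then show ?thesis
    unfolding act2_def w[of \<alpha> \<beta>] by (simp add: sum_subtractf right_diff_distrib)
qed

lemma act_decomposable:
  assumes "\<Omega> \<in> forms p"
  shows "act (wedge_list [\<alpha>, \<beta>]) \<Omega> vs =
    (\<alpha> \<and>\<^sub>1 interior (sharp \<beta>) \<Omega>) vs - (\<beta> \<and>\<^sub>1 interior (sharp \<alpha>) \<Omega>) vs"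
proof -
  have "act2 \<alpha> \<beta> \<Omega> vs = 1/2 * (act2 \<alpha> \<beta> \<Omega> vs - act2 \<beta> \<alpha> \<Omega> vs)"
    by (simp add: act2_def)
  also have "\<dots> = act (wedge_list [\<alpha>, \<beta>]) \<Omega> vs"
    unfolding act2_bilinear[OF assms, of \<alpha> \<beta>] act2_bilinear[OF assms, of \<beta> \<alpha>]
      sum_subtractf[symmetric] act_def
    by (simp add: wedge_list_2 algebra_simps)
  finally show ?thesis by (simp add: act2_def)
qed

end

theory Submission
  imports Defs
begin

text \<open>
  Write \<open>f x y z w\<close> for \<open>F(x, y, z, w)\<close> and \<open>br x y z\<close> for the vector dual to \<open>F(x, y, z, -)\<close>.  The
  condition says that every \<open>br x y\<close> is a derivation of \<open>F\<close> (the Jacobi identity of a metric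
  3-Lie algebra).

  Let \<open>L\<close> be the maximum of \<open>F\<close> over unit vectors, attained at \<open>e\<^sub>1, \<dots>, e\<^sub>4\<close>.  If \<open>L \<noteq> 0\<close>, maximality in
  each slot gives \<open>F(x, e\<^sub>2, e\<^sub>3, e\<^sub>4) = L \<langle>e\<^sub>1, x\<rangle>\<close> and so on; hence the \<open>e\<^sub>i\<close> are orthonormal and \<open>F\<close> has no
  component with exactly three legs in their span \<open>W\<close>.  The maps \<open>br e\<^sub>i e\<^sub>j\<close> restricted to the
  orthogonal complement of \<open>W\<close>, of dimension at most 3, are vectors of \<open>\<real>\<^sup>3\<close> under the cross product and
  represent \<open>so(4) = so(3) \<oplus> so(3)\<close>.  In \<open>so(3)\<close> one of the two commuting factors must act by zero, and
  the remaining instance of the Jacobi identity makes their Casimir operators equal, so both act by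
  zero.  A last use of the Jacobi identity kills the components with one leg in \<open>W\<close>, and
  \<open>F = L e\<^sup>1 \<and> e\<^sup>2 \<and> e\<^sup>3 \<and> e\<^sup>4\<close>.

  Conversely, if \<open>F = \<alpha>\<^sub>1 \<and> \<alpha>\<^sub>2 \<and> \<alpha>\<^sub>3 \<and> \<alpha>\<^sub>4\<close>, the transpose of \<open>br X Y\<close> maps the span of the \<open>\<alpha>\<^sub>i\<close> to itself by
  a matrix that is the product of the Gram matrix with a skew matrix.  It has trace zero, so the
  derivation annihilates \<open>F\<close>.
\<close>

section \<open>Alternating 4-linear functions and their maximum over unit balls\<close>

locale alternating4 =
  fixes f :: "'a::euclidean_space \<Rightarrow> 'a \<Rightarrow> 'a \<Rightarrow> 'a \<Rightarrow> real"
  assumes lin1: "linear (\<lambda>x. f x y z w)"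
    and swap12: "f y x z w = - f x y z w"
    and swap23: "f x z y w = - f x y z w"
    and swap34: "f x y w z = - f x y z w"
begin

lemma swap13: "f z y x w = - f x y z w"
  by (metis swap12 swap23)

lemma swap14: "f w y z x = - f x y z w"
  by (metis swap13 swap34)

lemma lin2: "linear (\<lambda>y. f x y z w)"
  using linear_compose_neg[OF lin1[of x z w]] by (simp add: swap12[of x])

lemma lin3: "linear (\<lambda>z. f x y z w)"
  using linear_compose_neg[OF lin1[of y x w]] by (simp add: swap13[of x])

lemma lin4: "linear (\<lambda>w. f x y z w)"
  using linear_compose_neg[OF lin1[of y z x]] by (simp add: swap14[of x])

lemmas f_linear =
  lin1[THEN linear_add] lin2[THEN linear_add] lin3[THEN linear_add] lin4[THEN linear_add]
  lin1[THEN linear_cmul] lin2[THEN linear_cmul] lin3[THEN linear_cmul] lin4[THEN linear_cmul]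
  lin1[THEN linear_diff] lin2[THEN linear_diff] lin3[THEN linear_diff] lin4[THEN linear_diff]
  lin1[THEN linear_neg] lin2[THEN linear_neg] lin3[THEN linear_neg] lin4[THEN linear_neg]
  lin1[THEN linear_0] lin2[THEN linear_0] lin3[THEN linear_0] lin4[THEN linear_0]

lemma f_repeat:
  "f x x y z = 0" "f x y x z = 0" "f x y z x = 0" "f y x x z = 0" "f y x z x = 0" "f y z x x = 0"
  using swap12[of x x y z] swap13[of x y x z] swap14[of x y z x] swap23[of y x x z] swap34[of y z x x]
    swap34[of y x z x] swap23[of y x x z] by simp_all

definition br :: "'a \<Rightarrow> 'a \<Rightarrow> 'a \<Rightarrow> 'a" where
  "br x y z = (\<Sum>b\<in>Basis. f x y z b *\<^sub>R b)"

lemma br_inner [simp]: "br x y z \<bullet> w = f x y z w"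
proof -
  have "f x y z w = f x y z (\<Sum>b\<in>Basis. (w \<bullet> b) *\<^sub>R b)"
    by (simp add: euclidean_representation)
  also have "\<dots> = (\<Sum>b\<in>Basis. (w \<bullet> b) * f x y z b)"
    by (simp add: linear_sum[OF lin4] f_linear)
  also have "\<dots> = br x y z \<bullet> w"
    unfolding br_def inner_sum_left by (simp add: inner_commute[of _ w] mult.commute)
  finally show ?thesis ..
qed

lemma br_eqI: "(\<And>w. f x y z w = v \<bullet> w) \<Longrightarrow> br x y z = v"
  by (metis br_inner vector_eq_rdot)

text \<open>Compactness of a product of closed balls. Balls instead of spheres make the maximum
  visibly nonnegative; that the maximizers have norm 1 comes out later, when the maximum is
  nonzero.\<close>

lemma bounded_max:
  obtains a b c d where "norm a \<le> 1" "norm b \<le> 1" "norm c \<le> 1" "norm d \<le> 1"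
    "\<And>x y z w. norm x \<le> 1 \<Longrightarrow> norm y \<le> 1 \<Longrightarrow> norm z \<le> 1 \<Longrightarrow> norm w \<le> 1
      \<Longrightarrow> f x y z w \<le> f a b c d"
proof -
  let ?S = "cball (0::'a) 1 \<times> cball (0::'a) 1 \<times> cball (0::'a) 1 \<times> cball (0::'a) 1"
  \<comment> \<open>Coordinates turn \<open>f\<close> into a polynomial, whose continuity is
    immediate.\<close>
  have expand: "f x y z w = (\<Sum>i\<in>Basis. \<Sum>j\<in>Basis. \<Sum>k\<in>Basis. \<Sum>l\<in>Basis.
      (x \<bullet> i) * ((y \<bullet> j) * ((z \<bullet> k) * ((w \<bullet> l) * f i j k l))))" for x y z w
  proof -
    have 1: "f x y z w = (\<Sum>i\<in>Basis. (x \<bullet> i) * f i y z w)" for x y z w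
      by (subst euclidean_representation[of x, symmetric]) (simp add: linear_sum[OF lin1] f_linear)
    have 2: "f x y z w = (\<Sum>i\<in>Basis. (y \<bullet> i) * f x i z w)" for x y z w
      by (subst euclidean_representation[of y, symmetric]) (simp add: linear_sum[OF lin2] f_linear)
    have 3: "f x y z w = (\<Sum>i\<in>Basis. (z \<bullet> i) * f x y i w)" for x y z w
      by (subst euclidean_representation[of z, symmetric]) (simp add: linear_sum[OF lin3] f_linear)
    have 4: "f x y z w = (\<Sum>i\<in>Basis. (w \<bullet> i) * f x y z i)" for x y z w
      by (subst euclidean_representation[of w, symmetric]) (simp add: linear_sum[OF lin4] f_linear)
    show ?thesis
      by (subst 1, subst 2, subst 3, subst 4) (simp add: sum_distrib_left)
  qed
  have "continuous_on ?S (\<lambda>(x, y, z, w). f x y z w)"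
    unfolding case_prod_beta by (subst expand) (intro continuous_intros)
  then have "\<exists>s\<in>?S. \<forall>t\<in>?S. (\<lambda>(x, y, z, w). f x y z w) t \<le> (\<lambda>(x, y, z, w). f x y z w) s"
    by (intro continuous_attains_sup compact_Times compact_cball) auto
  then obtain s where s: "s \<in> ?S"
    "\<forall>t\<in>?S. (\<lambda>(x, y, z, w). f x y z w) t \<le> (\<lambda>(x, y, z, w). f x y z w) s"
    by blast
  obtain a b c d where "s = (a, b, c, d)" by (cases s) auto
  have "norm a \<le> 1" "norm b \<le> 1" "norm c \<le> 1" "norm d \<le> 1"
    using s(1) by (simp_all add: \<open>s = (a, b, c, d)\<close>)
  moreover have "f x y z w \<le> f a b c d"
    if "norm x \<le> 1" "norm y \<le> 1" "norm z \<le> 1" "norm w \<le> 1" for x y z w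
    using bspec[OF s(2), of "(x, y, z, w)"] that by (simp add: \<open>s = (a, b, c, d)\<close>)
  ultimately show ?thesis by (rule that)
qed

end

text \<open>Equality case of Cauchy-Schwarz: if \<open>v\<close> represents \<open>g\<close>, then
  |v| <= L, <v, a> = L and |a| <= 1, so |v - L a|^2 <= L^2 - 2 L^2 + L^2 = 0.\<close>

lemma linear_functional_attaining_norm:
  fixes g :: "'a::euclidean_space \<Rightarrow> real"
  assumes "linear g" and le: "\<And>x. norm x \<le> 1 \<Longrightarrow> g x \<le> L"
    and "norm a \<le> 1" and "g a = L"
  shows "g x = L * (a \<bullet> x)"
proof -
  obtain v where v: "\<And>x. g x = v \<bullet> x"
  proof
    show "g x = sharp (Blinfun g) \<bullet> x" for x
      using assms(1) by (simp add: sharp_inner bounded_linear_Blinfun_apply linear_conv_bounded_linear)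
  qed
  have "0 \<le> L" using le[of 0] by (simp add: v)
  have "norm v \<le> L"
  proof (cases "v = 0")
    case False
    have "norm v = g (v /\<^sub>R norm v)"
      using False by (simp add: v dot_square_norm power2_eq_square)
    also have "\<dots> \<le> L" using False by (intro le) simp
    finally show ?thesis .
  qed (use \<open>0 \<le> L\<close> in simp)
  then have "v \<bullet> v \<le> L\<^sup>2" by (simp add: dot_square_norm power_mono)
  moreover have "L\<^sup>2 * (a \<bullet> a) \<le> L\<^sup>2"
    using \<open>norm a \<le> 1\<close> by (simp add: dot_square_norm mult_left_le power_le_one)
  moreover have "v \<bullet> a = L" using assms(4) v by simp
  then have "(v - L *\<^sub>R a) \<bullet> (v - L *\<^sub>R a) = v \<bullet> v - 2 * L\<^sup>2 + L\<^sup>2 * (a \<bullet> a)"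
    by (simp add: inner_diff_left inner_diff_right inner_commute[of a v] power2_eq_square algebra_simps)
  ultimately have "(v - L *\<^sub>R a) \<bullet> (v - L *\<^sub>R a) \<le> 0" by linarith
  then have "v = L *\<^sub>R a"
    by (metis eq_iff_diff_eq_0 inner_eq_zero_iff inner_ge_zero order_antisym)
  then show ?thesis by (simp add: v)
qed

section \<open>Commuting triples under the cross product, and a frame of the complement\<close>

unbundle cross3_syntax

text \<open>If some \<open>p\<close> is nonzero, every \<open>q\<close> is parallel to it, so all
  products among the \<open>q\<close> vanish, and with them the \<open>q\<close> themselves because
  \<open>c \<noteq> 0\<close>. The equal sums of squares (the Casimir operators) then force the
  \<open>p\<close> to vanish, a contradiction. The same equality finally kills the
  \<open>q\<close>.\<close>

lemma commuting_cross_triples_zero: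
  fixes p1 p2 p3 q1 q2 q3 :: "real^3"
  assumes c: "c \<noteq> 0"
    and "p1 \<times> p2 = c *\<^sub>R p3" "p2 \<times> p3 = c *\<^sub>R p1" "p3 \<times> p1 = c *\<^sub>R p2"
    and "q1 \<times> q2 = c *\<^sub>R q3" "q2 \<times> q3 = c *\<^sub>R q1" "q3 \<times> q1 = c *\<^sub>R q2"
    and pq: "\<And>p q. p \<in> {p1, p2, p3} \<Longrightarrow> q \<in> {q1, q2, q3} \<Longrightarrow> p \<times> q = 0"
    and "p1 \<bullet> p1 + p2 \<bullet> p2 + p3 \<bullet> p3 = q1 \<bullet> q1 + q2 \<bullet> q2 + q3 \<bullet> q3"
  shows "p1 = 0 \<and> p2 = 0 \<and> p3 = 0 \<and> q1 = 0 \<and> q2 = 0 \<and> q3 = 0"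
proof -
  have sq: "x = 0 \<and> y = 0 \<and> z = 0" if "x \<bullet> x + y \<bullet> y + z \<bullet> z = 0" for x y z :: "real^3"
    using that inner_ge_zero[of x] inner_ge_zero[of y] inner_ge_zero[of z]
    by (simp add: add_nonneg_eq_0_iff)
  have "p = 0" if p: "p \<in> {p1, p2, p3}" for p
  proof (rule ccontr)
    assume "p \<noteq> 0"
    have "\<exists>t. q = t *\<^sub>R p" if "q \<in> {q1, q2, q3}" for q
      using pq[OF p that] \<open>p \<noteq> 0\<close> by (metis collinear_lemma cross_eq_0 scaleR_zero_left)
    then have "q \<times> r = 0" if "q \<in> {q1, q2, q3}" "r \<in> {q1, q2, q3}" for q r
      using that by (metis cross_mult_left cross_mult_right cross_refl scaleR_zero_right)
    then have "c *\<^sub>R q3 = 0" "c *\<^sub>R q1 = 0" "c *\<^sub>R q2 = 0"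
      unfolding assms(5-7)[symmetric] by blast+
    then have "q1 = 0" "q2 = 0" "q3 = 0" using c by simp_all
    then have "p1 = 0 \<and> p2 = 0 \<and> p3 = 0" using assms(9) by (intro sq) simp
    with p \<open>p \<noteq> 0\<close> show False by auto
  qed
  then have "p1 = 0" "p2 = 0" "p3 = 0" by auto
  with assms(9) show ?thesis using sq[of q1 q2 q3] by simp
qed

text \<open>
  The vectors \<open>u\<^sub>i\<close> are an orthonormal basis of the complement padded with zeros, so that all
  dimensions below 8 are covered at once.
\<close>

lemma orthonormal_complement_frame:
  fixes e1 e2 e3 e4 :: "'a::euclidean_space"
  assumes "DIM('a) < 8"
    and orth: "pairwise orthogonal {e1, e2, e3, e4}" and "card {e1, e2, e3, e4} = 4"
    and "0 \<notin> {e1, e2, e3, e4}"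
  obtains u1 u2 u3 where "span ({e1, e2, e3, e4} \<union> {u1, u2, u3}) = UNIV"
    "\<And>e u. e \<in> {e1, e2, e3, e4} \<Longrightarrow> u \<in> {u1, u2, u3} \<Longrightarrow> e \<bullet> u = 0"
    "\<And>x. (\<And>e. e \<in> {e1, e2, e3, e4} \<Longrightarrow> e \<bullet> x = 0)
      \<Longrightarrow> x = (x \<bullet> u1) *\<^sub>R u1 + (x \<bullet> u2) *\<^sub>R u2 + (x \<bullet> u3) *\<^sub>R u3"
proof -
  let ?E = "{e1, e2, e3, e4}"
  let ?P = "{x. \<forall>e\<in>?E. e \<bullet> x = 0}"
  have indep: "independent ?E"
    using pairwise_orthogonal_independent[OF orth] assms(4) by blast
  then have dE: "dim (span ?E) = 4"
    using assms(3) by (metis dim_eq_card_independent dim_span)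
  have P: "?P = {y \<in> UNIV. \<forall>x\<in>span ?E. orthogonal x y}"
    using orthogonal_to_span[of _ ?E] span_base[of _ ?E]
    by (simp only: orthogonal_def) (fastforce simp: inner_commute)
  have "subspace ?P" unfolding P using subspace_orthogonal_to_vectors[of "span ?E"] by simp
  have "dim ?P + dim (span ?E) = DIM('a)"
    unfolding P using dim_subspace_orthogonal_to_vectors[of "span ?E" "UNIV::'a set"] by simp
  \<comment> \<open>The upper bound on the dimension enters here: 7 - 4 = 3, the dimension in which
    skew maps are vectors.\<close>
  then have "dim ?P \<le> 3" using dE assms(1) by linarith
  obtain B where B: "B \<subseteq> ?P" "pairwise orthogonal B" "\<And>x. x \<in> B \<Longrightarrow> norm x = 1"
    "independent B" "card B = dim ?P" "span B = ?P"
    using orthonormal_basis_subspace[OF \<open>subspace ?P\<close>] by blast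
  have "finite B" using B(4) independent_imp_finite by blast
  have rep: "x = (\<Sum>b\<in>B. (x \<bullet> b) *\<^sub>R b)" if "x \<in> ?P" for x
  proof -
    have "\<exists>c. x = (\<Sum>b\<in>B. c b *\<^sub>R b)"
      using that B(6) span_finite[OF \<open>finite B\<close>] by auto
    then obtain c where c: "x = (\<Sum>b\<in>B. c b *\<^sub>R b)" by blast
    have "x \<bullet> b = c b" if "b \<in> B" for b
    proof -
      have "x \<bullet> b = (\<Sum>a\<in>B. if a = b then c b else 0)"
        unfolding c inner_sum_left
        using B(2,3) that by (intro sum.cong) (auto simp: pairwise_def orthogonal_def norm_eq_1)
      then show ?thesis using that \<open>finite B\<close> by simp
    qed
    then show ?thesis using c by simp
  qed
  have "card B \<le> 3" using B(5) \<open>dim ?P \<le> 3\<close> by simp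
  then consider "card B = 0" | "card B = 1" | "card B = 2" | "card B = 3" by linarith
  then obtain u1 u2 u3 where u: "{u1, u2, u3} \<subseteq> insert 0 B" "B \<subseteq> {u1, u2, u3}"
    "\<And>x::'a. (\<Sum>b\<in>B. (x \<bullet> b) *\<^sub>R b) = (x \<bullet> u1) *\<^sub>R u1 + (x \<bullet> u2) *\<^sub>R u2 + (x \<bullet> u3) *\<^sub>R u3"
  proof cases
    case 1
    then have "B = {}" using \<open>finite B\<close> by simp
    then show ?thesis using that[of 0 0 0] by simp
  next
    case 2
    then obtain a where "B = {a}" by (rule card_1_singletonE)
    then show ?thesis using that[of a 0 0] by simp
  next
    case 3
    then obtain a b where "B = {a, b}" "a \<noteq> b" unfolding card_2_iff by blast
    then show ?thesis using that[of a b 0] by simp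
  next
    case 4
    then obtain a b c where "B = {a, b, c}" "a \<noteq> b" "b \<noteq> c" "a \<noteq> c" unfolding card_3_iff by blast
    then show ?thesis using that[of a b c] by (simp add: add.assoc)
  qed
  show ?thesis
  proof
    show "e \<bullet> u = 0" if "e \<in> ?E" "u \<in> {u1, u2, u3}" for e u
    proof -
      have "u = 0 \<or> u \<in> ?P" using that(2) u(1) B(1) by blast
      then show ?thesis using that(1) by auto
    qed
    show "x = (x \<bullet> u1) *\<^sub>R u1 + (x \<bullet> u2) *\<^sub>R u2 + (x \<bullet> u3) *\<^sub>R u3"
      if "\<And>e. e \<in> ?E \<Longrightarrow> e \<bullet> x = 0" for x
    proof -
      have "x \<in> ?P" using that by blast
      from rep[OF this] show ?thesis unfolding u(3) .
    qed
    show "span (?E \<union> {u1, u2, u3}) = UNIV"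
    proof (intro set_eqI iffI UNIV_I)
      fix x :: 'a
      obtain y z where "y \<in> span ?E" "\<And>w. w \<in> span ?E \<Longrightarrow> orthogonal z w" "x = y + z"
        using orthogonal_subspace_decomp_exists[of ?E x] by metis
      moreover from this have "z \<in> ?P" by (auto simp: orthogonal_def inner_commute span_base)
      then have "z \<in> span {u1, u2, u3}" using B(6) u(2) span_mono by blast
      ultimately show "x \<in> span (?E \<union> {u1, u2, u3})"
        by (metis Un_upper1 Un_upper2 span_add span_mono subsetD)
    qed
  qed
qed

text \<open>
  Laplace expansion along the first two vectors, with the row index starting at 0.
\<close>

definition minor :: "nat \<Rightarrow> nat \<Rightarrow> (nat \<Rightarrow> real) \<Rightarrow> (nat \<Rightarrow> real) \<Rightarrow> real" where
  "minor i j x y = x i * y j - x j * y i"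

definition det4 :: "(nat \<Rightarrow> real) \<Rightarrow> (nat \<Rightarrow> real) \<Rightarrow> (nat \<Rightarrow> real) \<Rightarrow> (nat \<Rightarrow> real) \<Rightarrow> real" where
  "det4 x y z w = minor 0 1 x y * minor 2 3 z w - minor 0 2 x y * minor 1 3 z w
    + minor 0 3 x y * minor 1 2 z w + minor 1 2 x y * minor 0 3 z w
    - minor 1 3 x y * minor 0 2 z w + minor 2 3 x y * minor 0 1 z w"

section \<open>The fundamental identity around a calibrated frame\<close>

text \<open>\<open>cal\<close> is the first-order condition at a maximum. The last three assumptions
  are what remains true of an orthonormal basis of the complement after padding with zeros.
  Orthogonality of the vectors in \<open>E\<close> is a consequence of \<open>cal\<close>.\<close>

locale calibrated4 = alternating4 f for f :: "'a::euclidean_space \<Rightarrow> 'a \<Rightarrow> 'a \<Rightarrow> 'a \<Rightarrow> real" +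
  fixes e1 e2 e3 e4 u1 u2 u3 :: 'a and L :: real
  assumes fundamental_identity:
      "f (br x y a) b c d + f a (br x y b) c d + f a b (br x y c) d + f a b c (br x y d) = 0"
    and L: "L \<noteq> 0"
    and cal: "f x e2 e3 e4 = L * (e1 \<bullet> x)" "f e1 x e3 e4 = L * (e2 \<bullet> x)"
      "f e1 e2 x e4 = L * (e3 \<bullet> x)" "f e1 e2 e3 x = L * (e4 \<bullet> x)"
    and unit: "\<And>e. e \<in> {e1, e2, e3, e4} \<Longrightarrow> e \<bullet> e = 1"
    and span: "span ({e1, e2, e3, e4} \<union> {u1, u2, u3}) = UNIV"
    and orth: "\<And>e u. e \<in> {e1, e2, e3, e4} \<Longrightarrow> u \<in> {u1, u2, u3} \<Longrightarrow> e \<bullet> u = 0"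
    and frame_expand: "\<And>x. (\<And>e. e \<in> {e1, e2, e3, e4} \<Longrightarrow> e \<bullet> x = 0)
      \<Longrightarrow> x = (x \<bullet> u1) *\<^sub>R u1 + (x \<bullet> u2) *\<^sub>R u2 + (x \<bullet> u3) *\<^sub>R u3"
begin

abbreviation "E \<equiv> {e1, e2, e3, e4}"
abbreviation "U \<equiv> {u1, u2, u3}"

text \<open>Three different frame vectors can be permuted into the pattern of \<open>cal\<close>,
  whose right-hand side pairs the missing one with \<open>w\<close>; a repeated argument gives zero
  by alternation.\<close>

lemma f_EEE_eq_0:
  assumes "x \<in> E" "y \<in> E" "z \<in> E" "\<And>e. e \<in> E \<Longrightarrow> e \<bullet> w = 0"
  shows "f x y z w = 0"
proof -
  have zero: "f e1 e2 e3 w = 0" "f e1 e2 e4 w = 0" "f e1 e3 e4 w = 0" "f e2 e3 e4 w = 0"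
    using cal[of w] assms(4) swap34[of e1 e2 e4 w] swap34[of e1 e3 e4 w] swap23[of e1 e3 w e4]
      swap34[of e2 e3 e4 w] swap23[of e2 e3 w e4] swap12[of e2 w e3 e4] by auto
  have perm: "f y x z w = 0" "f x z y w = 0" "f z y x w = 0" "f y z x w = 0" "f z x y w = 0"
    if "f x y z w = 0" for x y z
    using that swap12[of x y z w] swap12[of x z y w] swap12[of y z x w] swap23[of x y z w]
      swap23[of y x z w] by simp_all
  note zero perm[OF zero(1)] perm[OF zero(2)] perm[OF zero(3)] perm[OF zero(4)]
  then have "\<forall>x\<in>E. \<forall>y\<in>E. \<forall>z\<in>E. f x y z w = 0"
    by (simp add: f_repeat)
  then show ?thesis using assms(1-3) by blast
qed

text \<open>By \<open>f_EEE_eq_0\<close> the vector \<open>br x y u\<close> has no component along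
  \<open>E\<close>, so \<open>br x y\<close> preserves the complement and the frame expansion
  applies.\<close>

lemma br_EEU_expand:
  assumes "x \<in> E" "y \<in> E" "u \<in> U"
  shows "br x y u = f x y u u1 *\<^sub>R u1 + f x y u u2 *\<^sub>R u2 + f x y u u3 *\<^sub>R u3"
proof -
  have "e \<bullet> br x y u = 0" if "e \<in> E" for e
    using f_EEE_eq_0[of x y e u] that assms orth by (simp add: inner_commute[of e] swap34[of x y u e])
  from frame_expand[OF this] show ?thesis by simp
qed

text \<open>On the span of \<open>E\<close>, bracketing with two frame vectors is, up to sign,
  \<open>L\<close> times the infinitesimal rotation in the plane of the other two: the generators of
  so(4).\<close>

lemma br_EEE:
  "br e1 e2 e3 = L *\<^sub>R e4" "br e1 e2 e4 = - L *\<^sub>R e3" "br e1 e3 e4 = L *\<^sub>R e2" "br e2 e3 e4 = - L *\<^sub>R e1"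
proof -
  show "br e1 e2 e3 = L *\<^sub>R e4" by (rule br_eqI) (simp add: cal)
  show "br e1 e2 e4 = - L *\<^sub>R e3" by (rule br_eqI) (subst swap34, simp add: cal)
  show "br e1 e3 e4 = L *\<^sub>R e2" by (rule br_eqI) (subst swap34, subst swap23, simp add: cal)
  show "br e2 e3 e4 = - L *\<^sub>R e1"
    by (rule br_eqI) (subst swap34, subst swap23, subst swap12, simp add: cal)
qed

text \<open>
  \<open>V x y\<close> is the axial vector of the skew map \<open>br x y\<close> on the span of \<open>u\<^sub>1, u\<^sub>2, u\<^sub>3\<close>.
\<close>

definition V :: "'a \<Rightarrow> 'a \<Rightarrow> real^3" where
  "V x y = vector [f x y u2 u3, f x y u3 u1, f x y u1 u2]"

lemma V_linear:
  "V x (c *\<^sub>R y) = c *\<^sub>R V x y" "V (c *\<^sub>R x) y = c *\<^sub>R V x y" "V x 0 = 0" "V 0 y = 0"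
  "V x (- y) = - V x y" "V (- x) y = - V x y" "V x x = 0"
  by (simp_all add: V_def vec_eq_iff forall_3 f_linear f_repeat)

lemma V_swap: "V y x = - V x y"
  by (simp add: V_def vec_eq_iff forall_3 swap12[of x])

text \<open>On the complement, the fundamental identity equates the commutator of
  \<open>br x y\<close> and \<open>br z w\<close> with
  \<open>br (br x y z) w + br z (br x y w)\<close>, and the commutator of skew maps of three-space
  is the cross product of their axial vectors.\<close>

lemma cross_V:
  assumes "x \<in> E" "y \<in> E" "z \<in> E" "w \<in> E"
  shows "V x y \<times> V z w = V (br x y z) w + V z (br x y w)"
proof -
  have fi: "f (br x y z) w u v + f z (br x y w) u v = - f z w (br x y u) v - f z w u (br x y v)" for u v
    using fundamental_identity[of x y z w u v] by linarith
  note swap = swap34[of _ _ u1 u2] swap34[of _ _ u2 u3] swap34[of _ _ u3 u1]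
  have "f (br x y z) w u2 u3 + f z (br x y w) u2 u3 = f x y u3 u1 * f z w u1 u2 - f x y u1 u2 * f z w u3 u1"
    "f (br x y z) w u3 u1 + f z (br x y w) u3 u1 = f x y u1 u2 * f z w u2 u3 - f x y u2 u3 * f z w u1 u2"
    "f (br x y z) w u1 u2 + f z (br x y w) u1 u2 = f x y u2 u3 * f z w u3 u1 - f x y u3 u1 * f z w u2 u3"
    unfolding fi by (simp_all add: br_EEU_expand[OF assms(1,2)] f_linear f_repeat swap)
  then show ?thesis
    by (simp add: V_def vec_eq_iff forall_3 cross3_def)
qed

lemma br_swap: "br y x z = - br x y z" "br x z y = - br x y z"
  by (rule br_eqI, simp, rule swap12, rule br_eqI, simp, rule swap23)

lemma br_repeat: "br x x y = 0" "br x y x = 0" "br y x x = 0"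
  by (rule br_eqI, simp add: f_repeat)+

lemma br_EEE_perm:
  "br e1 e3 e2 = - L *\<^sub>R e4" "br e1 e4 e2 = L *\<^sub>R e3" "br e1 e4 e3 = - L *\<^sub>R e2" "br e2 e3 e1 = L *\<^sub>R e4"
  "br e2 e4 e1 = - L *\<^sub>R e3" "br e2 e4 e3 = L *\<^sub>R e1" "br e3 e4 e1 = L *\<^sub>R e2" "br e3 e4 e2 = - L *\<^sub>R e1"
  by (simp_all add: br_EEE br_swap(2)[of e1 e3 e2] br_swap(2)[of e1 e4 e2] br_swap(2)[of e1 e4 e3]
      br_swap(2)[of e2 e3 e1] br_swap(2)[of e2 e4 e1] br_swap(2)[of e2 e4 e3] br_swap(2)[of e3 e4 e1]
      br_swap(2)[of e3 e4 e2] br_swap(1)[of e2 e1 e3] br_swap(1)[of e2 e1 e4] br_swap(1)[of e3 e1 e4]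
      br_swap(1)[of e3 e2 e4])

text \<open>Use the derivation \<open>br e3 u\<close> on the arguments \<open>e1\<close>,
  \<open>e2\<close>, \<open>e4\<close>, \<open>u\<close> and sum over \<open>U\<close>. The terms
  become traces of products of two skew maps, and such a trace is -2 times the inner product of the
  axial vectors.\<close>

lemma V_trace: "V e1 e3 \<bullet> V e2 e4 - V e1 e4 \<bullet> V e2 e3 - V e1 e2 \<bullet> V e3 e4 = 0"
proof -
  have fi: "f e2 e4 (br e1 e3 u) v - f e1 e4 (br e2 e3 u) v - f e1 e2 (br e3 e4 u) v = 0"
    if "v = u" for u v
  proof -
    have "br e3 u e1 = br e1 e3 u" "br e3 u e2 = br e2 e3 u" "br e3 u e4 = - br e3 e4 u"
      by (metis br_swap minus_minus)+
    \<comment> \<open>\<open>cal\<close> makes this a multiple of \<open>f e3 u v e3\<close>, which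
      has a repeated argument.\<close>
    moreover have "f e1 e2 e4 (br e3 u v) = 0"
      using that swap34[of e1 e2 "br e3 u v" e4] by (simp add: cal inner_commute[of e3] f_repeat)
    moreover have "f (br e1 e3 u) e2 e4 v = f e2 e4 (br e1 e3 u) v"
      by (metis swap12 swap23 minus_minus)
    moreover have "f e1 (br e2 e3 u) e4 v = - f e1 e4 (br e2 e3 u) v"
      by (metis swap23)
    ultimately show ?thesis
      using fundamental_identity[of e3 u e1 e2 e4 v] by (simp add: f_linear)
  qed
  show ?thesis
    using fi[of u1 u1] fi[of u2 u2] fi[of u3 u3]
    by (simp add: br_EEU_expand f_linear f_repeat V_def inner_vec_def sum_3
      swap34[of _ _ u1 u2] swap34[of _ _ u2 u3] swap34[of _ _ u3 u1]) (simp add: algebra_simps)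
qed

text \<open>By \<open>cross_V\<close> and \<open>br_EEE\<close> the vectors \<open>V\<close> satisfy
  the relations of so(4). Its two so(3) ideals commute, which is the situation of
  \<open>commuting_cross_triples_zero\<close>.\<close>

lemma V_EE_eq_0:
  assumes "x \<in> E" "y \<in> E"
  shows "V x y = 0"
proof -
  \<comment> \<open>the self-dual and anti-self-dual combinations\<close>
  let ?P1 = "V e1 e2 + V e3 e4" and ?P2 = "V e1 e3 - V e2 e4" and ?P3 = "V e1 e4 + V e2 e3"
  let ?Q1 = "V e1 e2 - V e3 e4" and ?Q2 = "V e1 e3 + V e2 e4" and ?Q3 = "V e1 e4 - V e2 e3"
  have two: "(2 * L) *\<^sub>R v = L *\<^sub>R v + L *\<^sub>R v" for v :: "real^3"
    by (metis mult_2 scaleR_left_distrib)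
  note s = two cross_add_left cross_add_right Cross3.left_diff_distrib Cross3.right_diff_distrib
    cross_minus_left cross_minus_right cross_V br_EEE br_EEE_perm
    br_repeat V_linear V_swap[of e2 e1] V_swap[of e3 e1] V_swap[of e4 e1] V_swap[of e3 e2]
    V_swap[of e4 e2] V_swap[of e4 e3]
  have "?P1 = 0 \<and> ?P2 = 0 \<and> ?P3 = 0 \<and> ?Q1 = 0 \<and> ?Q2 = 0 \<and> ?Q3 = 0"
  proof (rule commuting_cross_triples_zero)
    show "2 * L \<noteq> 0" using L by simp
    show "?P1 \<times> ?P2 = (2 * L) *\<^sub>R ?P3" "?P2 \<times> ?P3 = (2 * L) *\<^sub>R ?P1" "?P3 \<times> ?P1 = (2 * L) *\<^sub>R ?P2"
      "?Q1 \<times> ?Q2 = (2 * L) *\<^sub>R ?Q3" "?Q2 \<times> ?Q3 = (2 * L) *\<^sub>R ?Q1" "?Q3 \<times> ?Q1 = (2 * L) *\<^sub>R ?Q2"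
      by (simp_all add: s) (simp_all add: algebra_simps)
    have "\<forall>p\<in>{?P1, ?P2, ?P3}. \<forall>q\<in>{?Q1, ?Q2, ?Q3}. p \<times> q = 0"
      by (simp add: s)
    then show "p \<times> q = 0" if "p \<in> {?P1, ?P2, ?P3}" "q \<in> {?Q1, ?Q2, ?Q3}" for p q
      using that by blast
    \<comment> \<open>The two sides differ by -4 times the left side of
      \<open>V_trace\<close>.\<close>
    show "?P1 \<bullet> ?P1 + ?P2 \<bullet> ?P2 + ?P3 \<bullet> ?P3 = ?Q1 \<bullet> ?Q1 + ?Q2 \<bullet> ?Q2 + ?Q3 \<bullet> ?Q3"
      using V_trace by (simp add: algebra_simps inner_commute)
  qed
  moreover have half: "a = 0 \<and> b = 0" if "a + b = 0" "a - b = 0" for a b :: "real^3"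
  proof -
    have "b = a" using that(2) by simp
    then have "2 *\<^sub>R a = 0" using that(1) by (simp only: scaleR_2)
    with \<open>b = a\<close> show ?thesis by simp
  qed
  ultimately have "V e1 e2 = 0 \<and> V e3 e4 = 0" "V e2 e4 = 0 \<and> V e1 e3 = 0" "V e1 e4 = 0 \<and> V e2 e3 = 0"
    using half[of "V e1 e2" "V e3 e4"] half[of "V e1 e3" "V e2 e4"] half[of "V e1 e4" "V e2 e3"] by blast+
  then have "\<forall>x\<in>E. \<forall>y\<in>E. V x y = 0"
    by (simp add: V_linear V_swap[of e2 e1] V_swap[of e3 e1] V_swap[of e4 e1] V_swap[of e3 e2]
      V_swap[of e4 e2] V_swap[of e4 e3])
  then show ?thesis using assms by blast
qed

text \<open>A skew map of three-space is determined by its axial vector.\<close>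

lemma br_EEU_eq_0:
  assumes "x \<in> E" "y \<in> E" "u \<in> U"
  shows "br x y u = 0"
proof -
  have *: "f x y u2 u3 = 0" "f x y u3 u1 = 0" "f x y u1 u2 = 0"
    using V_EE_eq_0[OF assms(1,2)] by (simp_all add: V_def vec_eq_iff forall_3)
  then have "f x y u3 u2 = 0" "f x y u1 u3 = 0" "f x y u2 u1 = 0"
    using swap34[of x y u2 u3] swap34[of x y u3 u1] swap34[of x y u1 u2] by simp_all
  with * assms(3) show ?thesis unfolding br_EEU_expand[OF assms] by (auto simp: f_repeat)
qed

text \<open>As \<open>br x y\<close> annihilates \<open>U\<close>, only the term moving the first
  argument survives in the fundamental identity. Up to sign and the factor \<open>L\<close>, each
  frame vector is a bracket of the other three.\<close>

lemma f_EUUU_eq_0: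
  assumes "e \<in> E" "u \<in> U" "v \<in> U" "w \<in> U"
  shows "f e u v w = 0"
proof -
  have *: "f (br x y z) u v w = 0" if "x \<in> E" "y \<in> E" for x y z
    using fundamental_identity[of x y z u v w] that assms by (simp add: br_EEU_eq_0 f_linear)
  have "f e1 u v w = 0" "f e2 u v w = 0" "f e3 u v w = 0" "f e4 u v w = 0"
    using *[of e2 e3 e4] *[of e1 e3 e4] *[of e1 e2 e4] *[of e1 e2 e3] L by (simp_all add: br_EEE f_linear)
  with assms(1) show ?thesis by auto
qed

lemma linear_eq_0I:
  assumes "linear g" "\<And>x. x \<in> E \<Longrightarrow> g x = (0::real)" "\<And>x. x \<in> U \<Longrightarrow> g x = 0"
  shows "g x = 0"
proof (rule linear_eq_0_on_span[OF assms(1)])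
  show "x \<in> span (E \<union> U)" unfolding span by (rule UNIV_I)
  show "g y = 0" if "y \<in> E \<union> U" for y
    using that by (rule UnE) (erule assms(2,3))+
qed

text \<open>The components with a leg in \<open>U\<close> are sorted by their number of legs in
  \<open>E\<close>; each sort is zero by an earlier lemma or by repetition. Linearity then frees the
  arguments one at a time, the last one first.\<close>

lemma f_U_eq_0:
  assumes u: "u \<in> U"
  shows "f u x y z = 0"
proof -
  have UEEE: "f u a b c = 0" if "a \<in> E" "b \<in> E" "c \<in> E" for a b c
    using f_EEE_eq_0[of c a b u] swap14[of u a b c] orth[OF _ u] that by simp
  have UEEU: "f u a b c = 0" if "a \<in> E" "b \<in> E" "c \<in> U" for a b c
  proof -
    have "f b a u c = 0" using br_EEU_eq_0[of b a u] that u br_inner[of b a u c] by simp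
    then show ?thesis using swap13[of u a b c] by simp
  qed
  have UEUU: "f u a b c = 0" if "a \<in> E" "b \<in> U" "c \<in> U" for a b c
    using f_EUUU_eq_0[of a u b c] swap12[of a u b c] that u by simp
  have UUUU: "f u a b c = 0" if "a \<in> U" "b \<in> U" "c \<in> U" for a b c
  proof -
    \<comment> \<open>Four arguments taken from three vectors must repeat one.\<close>
    have "\<forall>u\<in>U. \<forall>a\<in>U. \<forall>b\<in>U. \<forall>c\<in>U. f u a b c = 0" by (simp add: f_repeat)
    then show ?thesis using u that by blast
  qed
  have UEE: "f u a b z = 0" if "a \<in> E" "b \<in> E" for a b z
    by (rule linear_eq_0I[OF lin4]) (rule UEEE[OF that] UEEU[OF that], assumption)+
  have UEU: "f u a b z = 0" if "a \<in> E" "b \<in> U" for a b z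
  proof (rule linear_eq_0I[OF lin4])
    show "f u a b c = 0" if "c \<in> E" for c
      using UEEU[of a c b] swap34[of u a b c] that \<open>a \<in> E\<close> \<open>b \<in> U\<close> by simp
  qed (rule UEUU[OF that])
  have UE: "f u a y z = 0" if "a \<in> E" for a y z
    by (rule linear_eq_0I[OF lin3]) (rule UEE[OF that] UEU[OF that], assumption)+
  have UUU: "f u a b z = 0" if "a \<in> U" "b \<in> U" for a b z
  proof (rule linear_eq_0I[OF lin4])
    show "f u a b c = 0" if "c \<in> E" for c
      using UE[OF that, of a b] swap34[of u a b c] swap23[of u c a b] by linarith
  qed (rule UUUU[OF that])
  have UU: "f u a y z = 0" if "a \<in> U" for a y z
  proof (rule linear_eq_0I[OF lin3])
    show "f u a b z = 0" if "b \<in> E" for b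
      using UE[OF that, of a z] swap23[of u a b z] by simp
  qed (rule UUU[OF that])
  show ?thesis
    by (rule linear_eq_0I[OF lin2]) (erule UE UU)+
qed

text \<open>Putting another frame vector into \<open>cal\<close> repeats an argument, so the left
  side is zero while \<open>L\<close> is not.\<close>

lemma e_orthogonal: "e1 \<bullet> e2 = 0" "e1 \<bullet> e3 = 0" "e1 \<bullet> e4 = 0" "e2 \<bullet> e3 = 0" "e2 \<bullet> e4 = 0" "e3 \<bullet> e4 = 0"
  using cal(1)[of e2] cal(1)[of e3] cal(1)[of e4] cal(2)[of e3] cal(2)[of e4] cal(3)[of e4] L
  by (simp_all add: f_repeat)

text \<open>Both sides agree on \<open>E\<close> by orthonormality and on \<open>U\<close> by
  \<open>f_U_eq_0\<close>.\<close>

lemma f_expand1: "f x y z w = (e1 \<bullet> x) * f e1 y z w + (e2 \<bullet> x) * f e2 y z w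
    + (e3 \<bullet> x) * f e3 y z w + (e4 \<bullet> x) * f e4 y z w"
proof -
  let ?g = "\<lambda>x. f x y z w - ((e1 \<bullet> x) * f e1 y z w + (e2 \<bullet> x) * f e2 y z w
    + (e3 \<bullet> x) * f e3 y z w + (e4 \<bullet> x) * f e4 y z w)"
  have lin: "linear ?g"
    by (rule linearI) (simp_all add: f_linear inner_add_right algebra_simps)
  have E: "\<forall>x\<in>E. ?g x = 0"
    using unit by (simp add: e_orthogonal inner_commute[of e2 e1] inner_commute[of e3 e1] inner_commute[of e4 e1]
      inner_commute[of e3 e2] inner_commute[of e4 e2] inner_commute[of e4 e3])
  have U: "\<forall>x\<in>U. ?g x = 0"
    using f_U_eq_0 orth by simp
  have "?g x = 0" by (rule linear_eq_0I[OF lin bspec[OF E] bspec[OF U]])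
  then show ?thesis by simp
qed

lemma f_expand2: "f x y z w = (e1 \<bullet> y) * f x e1 z w + (e2 \<bullet> y) * f x e2 z w
    + (e3 \<bullet> y) * f x e3 z w + (e4 \<bullet> y) * f x e4 z w"
  using f_expand1[of y x z w] by (simp add: swap12[of x])

lemma f_expand3: "f x y z w = (e1 \<bullet> z) * f x y e1 w + (e2 \<bullet> z) * f x y e2 w
    + (e3 \<bullet> z) * f x y e3 w + (e4 \<bullet> z) * f x y e4 w"
  using f_expand1[of z y x w] by (simp add: swap13[of x])

lemma f_EEE_eval:
  "f e1 e2 e3 w = L * (e4 \<bullet> w)" "f e1 e2 e4 w = - L * (e3 \<bullet> w)"
  "f e1 e3 e4 w = L * (e2 \<bullet> w)" "f e2 e3 e4 w = - L * (e1 \<bullet> w)"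
  using br_EEE[THEN arg_cong, of "\<lambda>v. v \<bullet> w"] by simp_all

text \<open>Expanding the first two arguments produces the minors of \<open>x\<close> and
  \<open>y\<close>; expanding the third produces the complementary minors of \<open>z\<close> and
  \<open>w\<close> with the signs of Laplace expansion.\<close>

lemma f_eq_det4:
  "f x y z w = L * det4 (\<lambda>i. [e1, e2, e3, e4] ! i \<bullet> x) (\<lambda>i. [e1, e2, e3, e4] ! i \<bullet> y)
     (\<lambda>i. [e1, e2, e3, e4] ! i \<bullet> z) (\<lambda>i. [e1, e2, e3, e4] ! i \<bullet> w)"
proof -
  have perm: "f b a c w = - t" "f a c b w = - t" "f c b a w = - t" "f b c a w = t" "f c a b w = t"
    if "f a b c w = t" for a b c w t
    using that swap12[of a b c w] swap12[of a c b w] swap12[of b c a w] swap23[of a b c w]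
      swap23[of b a c w] by simp_all
  note table = f_EEE_eval f_EEE_eval[THEN perm(1)] f_EEE_eval[THEN perm(2)] f_EEE_eval[THEN perm(3)]
    f_EEE_eval[THEN perm(4)] f_EEE_eval[THEN perm(5)]
  have e2: "f e1 e2 z w = L * ((e3 \<bullet> z) * (e4 \<bullet> w) - (e4 \<bullet> z) * (e3 \<bullet> w))"
    "f e1 e3 z w = - L * ((e2 \<bullet> z) * (e4 \<bullet> w) - (e4 \<bullet> z) * (e2 \<bullet> w))"
    "f e1 e4 z w = L * ((e2 \<bullet> z) * (e3 \<bullet> w) - (e3 \<bullet> z) * (e2 \<bullet> w))"
    "f e2 e3 z w = L * ((e1 \<bullet> z) * (e4 \<bullet> w) - (e4 \<bullet> z) * (e1 \<bullet> w))"
    "f e2 e4 z w = - L * ((e1 \<bullet> z) * (e3 \<bullet> w) - (e3 \<bullet> z) * (e1 \<bullet> w))"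
    "f e3 e4 z w = L * ((e1 \<bullet> z) * (e2 \<bullet> w) - (e2 \<bullet> z) * (e1 \<bullet> w))"
    by (subst f_expand3, simp add: table f_repeat algebra_simps)+
  have "f x y z w = minor 0 1 (\<lambda>i. [e1, e2, e3, e4] ! i \<bullet> x) (\<lambda>i. [e1, e2, e3, e4] ! i \<bullet> y) * f e1 e2 z w
    + minor 0 2 (\<lambda>i. [e1, e2, e3, e4] ! i \<bullet> x) (\<lambda>i. [e1, e2, e3, e4] ! i \<bullet> y) * f e1 e3 z w
    + minor 0 3 (\<lambda>i. [e1, e2, e3, e4] ! i \<bullet> x) (\<lambda>i. [e1, e2, e3, e4] ! i \<bullet> y) * f e1 e4 z w
    + minor 1 2 (\<lambda>i. [e1, e2, e3, e4] ! i \<bullet> x) (\<lambda>i. [e1, e2, e3, e4] ! i \<bullet> y) * f e2 e3 z w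
    + minor 1 3 (\<lambda>i. [e1, e2, e3, e4] ! i \<bullet> x) (\<lambda>i. [e1, e2, e3, e4] ! i \<bullet> y) * f e2 e4 z w
    + minor 2 3 (\<lambda>i. [e1, e2, e3, e4] ! i \<bullet> x) (\<lambda>i. [e1, e2, e3, e4] ! i \<bullet> y) * f e3 e4 z w"
    by (subst f_expand1, subst (1 2 3 4) f_expand2)
      (simp add: f_repeat swap12[of e1 e2] swap12[of e1 e3] swap12[of e1 e4] swap12[of e2 e3]
        swap12[of e2 e4] swap12[of e3 e4] minor_def algebra_simps)
  then show ?thesis
    unfolding e2 det4_def by (simp add: minor_def algebra_simps)
qed

end

section \<open>Wedge products as 4-by-4 determinants\<close>

lemma wedge_list_Cons: "wedge_list (\<alpha> # \<alpha>s) vs = (\<alpha> \<and>\<^sub>1 wedge_list \<alpha>s) vs"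
  by (simp add: wedge_list_def)

text \<open>Wedging one covector at a time expands the determinant along rows, \<open>det4\<close>
  along the first two columns; the polynomials agree.\<close>

lemma wedge_list_4:
  assumes "length \<alpha>s = 4"
  shows "wedge_list \<alpha>s [x, y, z, w] = det4 (\<lambda>i. blinfun_apply (\<alpha>s ! i) x) (\<lambda>i. blinfun_apply (\<alpha>s ! i) y)
    (\<lambda>i. blinfun_apply (\<alpha>s ! i) z) (\<lambda>i. blinfun_apply (\<alpha>s ! i) w)"
proof -
  obtain \<alpha> \<beta> \<gamma> \<delta> where \<alpha>s: "\<alpha>s = [\<alpha>, \<beta>, \<gamma>, \<delta>]"
    using assms by (auto simp: length_Suc_conv eval_nat_numeral)
  have 3: "wedge_list [\<beta>, \<gamma>, \<delta>] [x, y, z] = \<beta> x * wedge_list [\<gamma>, \<delta>] [y, z]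
    - \<beta> y * wedge_list [\<gamma>, \<delta>] [x, z] + \<beta> z * wedge_list [\<gamma>, \<delta>] [x, y]" for x y z
    unfolding wedge_list_Cons[of \<beta>] by (simp add: wedge1_def)
  have "wedge_list \<alpha>s [x, y, z, w] = \<alpha> x * wedge_list [\<beta>, \<gamma>, \<delta>] [y, z, w]
    - \<alpha> y * wedge_list [\<beta>, \<gamma>, \<delta>] [x, z, w] + \<alpha> z * wedge_list [\<beta>, \<gamma>, \<delta>] [x, y, w]
    - \<alpha> w * wedge_list [\<beta>, \<gamma>, \<delta>] [x, y, z]"
    unfolding \<alpha>s wedge_list_Cons[of \<alpha>] by (simp add: wedge1_def eval_nat_numeral)
  then show ?thesis
    unfolding 3 wedge_list_2 by (simp add: \<alpha>s det4_def minor_def algebra_simps)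
qed

lemma wedge_list_eq_0: "length vs \<noteq> length \<alpha>s \<Longrightarrow> wedge_list \<alpha>s vs = 0"
proof (induction \<alpha>s arbitrary: vs)
  case Nil
  then show ?case by (simp add: wedge_list_def unit_form_def)
next
  case (Cons \<alpha> \<alpha>s)
  have "wedge_list \<alpha>s (take i vs @ drop (Suc i) vs) = 0" if "i < length vs" for i
    using that Cons.prems by (intro Cons.IH) auto
  then show ?case by (simp add: wedge_list_def wedge1_def)
qed

text \<open>The infinitesimal form of multiplicativity of the determinant: a derivation multiplies a
  top-degree form by its trace.\<close>

lemma det4_derivation:
  fixes M :: "nat \<Rightarrow> nat \<Rightarrow> real"
  defines "T x \<equiv> \<lambda>i. M i 0 * x 0 + M i 1 * x 1 + M i 2 * x 2 + M i 3 * x (3::nat)"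
  shows "det4 (T x) y z w + det4 x (T y) z w + det4 x y (T z) w + det4 x y z (T w)
    = (M 0 0 + M 1 1 + M 2 2 + M 3 3) * det4 x y z w"
proof -
  \<comment> \<open>By the Leibniz rule it is enough to differentiate 2-by-2 minors, and the result
    is again linear in minors.\<close>
  define D where "D i j x y = minor i j (T x) y + minor i j x (T y)" for i j x y
  have D: "D i j x y = M i 0 * minor 0 j x y + M i 1 * minor 1 j x y + M i 2 * minor 2 j x y
      + M i 3 * minor 3 j x y + M j 0 * minor i 0 x y + M j 1 * minor i 1 x y
      + M j 2 * minor i 2 x y + M j 3 * minor i 3 x y" for i j x y
    by (simp add: D_def T_def minor_def algebra_simps)
  have swap: "minor 1 0 x y = - minor 0 1 x y" "minor 2 0 x y = - minor 0 2 x y" "minor 3 0 x y = - minor 0 3 x y"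
    "minor 2 1 x y = - minor 1 2 x y" "minor 3 1 x y = - minor 1 3 x y" "minor 3 2 x y = - minor 2 3 x y"
    "minor i i x y = 0" for i x y
    by (simp_all add: minor_def)
  have "det4 (T x) y z w + det4 x (T y) z w + det4 x y (T z) w + det4 x y z (T w)
    = D 0 1 x y * minor 2 3 z w - D 0 2 x y * minor 1 3 z w
    + D 0 3 x y * minor 1 2 z w + D 1 2 x y * minor 0 3 z w
    - D 1 3 x y * minor 0 2 z w + D 2 3 x y * minor 0 1 z w
    + minor 0 1 x y * D 2 3 z w - minor 0 2 x y * D 1 3 z w
    + minor 0 3 x y * D 1 2 z w + minor 1 2 x y * D 0 3 z w
    - minor 1 3 x y * D 0 2 z w + minor 2 3 x y * D 0 1 z w"
    by (simp add: det4_def D_def distrib_left distrib_right)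
  also have "\<dots> = (M 0 0 + M 1 1 + M 2 2 + M 3 3) * det4 x y z w"
    unfolding D swap det4_def by (simp add: algebra_simps)
  finally show ?thesis .
qed

section \<open>The action of 2-forms as derivations\<close>

lemma interior_forms:
  assumes "F \<in> forms (Suc p)"
  shows "(\<lambda>vs. F (X # vs)) \<in> forms p"
proof -
  have "linear (\<lambda>x. F (X # vs[k := x]))" if "length vs = p" "k < p" for vs k
  proof -
    have "length (X # vs) = Suc p" "Suc k < Suc p" using that by auto
    then have "linear (\<lambda>x. F ((X # vs)[Suc k := x]))"
      using assms unfolding forms_def by blast
    then show ?thesis by simp
  qed
  then show ?thesis using assms unfolding forms_def by simp
qed

lemma forms_alternating4:
  assumes "F \<in> forms 4"
  shows "alternating4 (\<lambda>x y z w. F [x, y, z, w])"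
proof -
  have 3: "(\<lambda>vs. F (X # vs)) \<in> forms 3" for X using interior_forms[of F 3] assms by simp
  have 2: "(\<lambda>vs. F (X # Y # vs)) \<in> forms 2" for X Y
    using interior_forms[of "\<lambda>vs. F (X # vs)" 2 Y] 3[of X] by simp
  show ?thesis
    by (rule alternating4.intro)
      (rule forms_linear_Cons[OF assms] forms_swap[OF assms] forms_swap[OF 3] forms_swap[OF 2])+
qed

text \<open>Wedging with \<alpha> after contracting with the dual of \<beta> replaces each argument
  v in turn by \<alpha>(v) times that dual. So \<omega> acts as the derivation induced by
  \<open>T\<close>, where \<open>T v\<close> is dual to \<omega>(v, -). For \<omega> = F(X, Y, -, -)
  this \<open>T\<close> is the map \<open>br X Y\<close>.\<close>

lemma act_eq_derivation:
  fixes F :: "'a::euclidean_space list \<Rightarrow> real"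
  assumes \<omega>: "\<omega> \<in> forms 2" and F: "F \<in> forms 4"
  defines "T a \<equiv> \<Sum>j\<in>Basis. \<omega> [a, j] *\<^sub>R j"
  shows "act \<omega> F [a, b, c, d]
    = F [T a, b, c, d] + F [a, T b, c, d] + F [a, b, T c, d] + F [a, b, c, T d]"
proof -
  interpret alternating4 "\<lambda>x y z w. F [x, y, z, w]" by (rule forms_alternating4[OF F])
  define W where "W i j = (flat i \<and>\<^sub>1 interior j F) [a, b, c, d]" for i j
  have key: "(\<Sum>i\<in>Basis. \<Sum>j\<in>Basis. \<omega> [i, j] * ((i \<bullet> v) * g j)) = g (T v)" if "linear g" for g v
  proof -
    have *: "\<omega> [v, j] = (\<Sum>i\<in>Basis. (i \<bullet> v) * \<omega> [i, j])" for j
    proof -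
      have "\<omega> [v, j] = \<omega> [\<Sum>i\<in>Basis. (v \<bullet> i) *\<^sub>R i, j]" by (simp add: euclidean_representation)
      then show ?thesis
        by (simp add: linear_sum[OF forms_linear_Cons[OF \<omega>]] linear_cmul[OF forms_linear_Cons[OF \<omega>]]
            inner_commute)
    qed
    have "g (T v) = (\<Sum>j\<in>Basis. \<Sum>i\<in>Basis. \<omega> [i, j] * ((i \<bullet> v) * g j))"
      by (simp add: T_def linear_sum[OF that] linear_cmul[OF that] * sum_distrib_right sum_distrib_left
          mult_ac)
    then show ?thesis by (subst sum.swap) simp
  qed
  have W: "W i j = (i \<bullet> a) * F [j, b, c, d] - (i \<bullet> b) * F [j, a, c, d]
      + (i \<bullet> c) * F [j, a, b, d] - (i \<bullet> d) * F [j, a, b, c]" for i j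
    by (simp add: W_def wedge1_def interior_def eval_nat_numeral)
  let ?S = "\<Sum>i\<in>Basis. \<Sum>j\<in>Basis. \<omega> [i, j] * W i j"
  \<comment> \<open>Since \<omega> is skew, the two halves of \<open>act2\<close> contribute
    equally, which absorbs the factor 1/2 in \<open>act\<close>.\<close>
  have "(\<Sum>i\<in>Basis. \<Sum>j\<in>Basis. \<omega> [i, j] * W j i) = (\<Sum>i\<in>Basis. \<Sum>j\<in>Basis. \<omega> [j, i] * W i j)"
    by (rule sum.swap)
  also have "\<dots> = - ?S"
    by (subst forms_swap[OF \<omega>]) (simp add: sum_negf)
  finally have "act \<omega> F [a, b, c, d] = ?S"
    by (simp add: act_def act2_def W_def right_diff_distrib sum_subtractf)
  also have "\<dots> = F [T a, b, c, d] - F [T b, a, c, d] + F [T c, a, b, d] - F [T d, a, b, c]"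
    using key[OF lin1, of a b c d] key[OF lin1, of b a c d] key[OF lin1, of c a b d] key[OF lin1, of d a b c]
    by (simp add: W distrib_left right_diff_distrib sum.distrib sum_subtractf)
  also have "F [T b, a, c, d] = - F [a, T b, c, d]" by (rule swap12)
  also have "F [T c, a, b, d] = F [a, b, T c, d]"
    using swap12[of "T c" a b d] swap23[of a "T c" b d] by simp
  also have "F [T d, a, b, c] = - F [a, b, c, T d]"
    using swap12[of "T d" a b c] swap23[of a "T d" b c] swap34[of a b "T d" c] by simp
  finally show ?thesis by simp
qed

lemma act_eq_0:
  assumes "F \<in> forms 4" and "length vs \<noteq> 4"
  shows "act \<omega> F vs = 0"
proof -
  have "F (X # take k vs @ drop (Suc k) vs) = 0" if "k < length vs" for X k
    using assms that unfolding forms_def by simp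
  then show ?thesis by (simp add: act_def act2_def wedge1_def interior_def)
qed

lemma act_sum: "act (\<lambda>us. \<Sum>i\<in>A. c i * \<omega> i us) \<Omega> vs = (\<Sum>i\<in>A. c i * act (\<omega> i) \<Omega> vs)"
proof -
  have "(\<Sum>i\<in>A. c i * act (\<omega> i) \<Omega> vs)
      = 1/2 * (\<Sum>k\<in>A. \<Sum>i\<in>Basis. \<Sum>j\<in>Basis. c k * \<omega> k [i, j] * act2 (flat i) (flat j) \<Omega> vs)"
    by (simp add: act_def sum_distrib_left mult_ac)
  also have "\<dots> = 1/2 * (\<Sum>i\<in>Basis. \<Sum>j\<in>Basis. \<Sum>k\<in>A. c k * \<omega> k [i, j] * act2 (flat i) (flat j) \<Omega> vs)"
    by (subst sum.swap, subst (2) sum.swap) simp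
  finally show ?thesis by (simp add: act_def sum_distrib_right)
qed

text \<open>The contraction is a linear combination of the forms F(i, j, -, -) and the action is
  linear in its 2-form, so decomposable bivectors suffice.\<close>

lemma act_contract_eq_0:
  fixes F :: "'a::euclidean_space list \<Rightarrow> real"
  assumes "\<And>X Y. act (\<lambda>us. F (X # Y # us)) F vs = 0"
  shows "act (contract \<Xi> F) F vs = 0"
proof -
  have "contract \<Xi> F = (\<lambda>us. \<Sum>i\<in>Basis. 1/2 * (\<Sum>j\<in>Basis. \<Xi> [flat i, flat j] * F (i # j # us)))"
    by (simp add: contract_def fun_eq_iff sum_distrib_left)
  then show ?thesis by (simp only: act_sum assms) simp
qed

lemma wedge_vec_forms: "wedge_vec X Y \<in> forms 2"
proof -
  have "linear (\<lambda>\<alpha>. wedge_vec X Y (\<alpha>s[i := \<alpha>]))" if len: "length \<alpha>s = 2" and "i < 2" for \<alpha>s i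
  proof -
    obtain \<alpha> \<beta> where "\<alpha>s = [\<alpha>, \<beta>]" using len by (auto simp: length_Suc_conv numeral_2_eq_2)
    moreover have "i = 0 \<or> i = 1" using that by auto
    ultimately show ?thesis
      by (auto intro!: linearI simp: wedge_vec_def blinfun.add_left blinfun.scaleR_left algebra_simps)
  qed
  moreover have "wedge_vec X Y \<alpha>s = 0" if len: "length \<alpha>s = 2" and "\<not> distinct \<alpha>s" for \<alpha>s
  proof -
    obtain \<alpha> \<beta> where "\<alpha>s = [\<alpha>, \<beta>]" using len by (auto simp: length_Suc_conv numeral_2_eq_2)
    then show ?thesis using that by (simp add: wedge_vec_def)
  qed
  ultimately show ?thesis by (simp add: forms_def wedge_vec_def)
qed

section \<open>From the fundamental identity to simplicity\<close>

lemma (in alternating4) eq_0_of_max_0: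
  assumes "\<And>x y z w. norm x \<le> 1 \<Longrightarrow> norm y \<le> 1 \<Longrightarrow> norm z \<le> 1 \<Longrightarrow> norm w \<le> 1 \<Longrightarrow> f x y z w \<le> 0"
  shows "f x y z w = 0"
proof -
  \<comment> \<open>The bound 0 is attained at the vector 0, so the functional is 0 times an inner
    product. Each use below removes the norm restriction on one more argument.\<close>
  have lin0: "g x = 0" if "linear g" "\<And>x. norm x \<le> 1 \<Longrightarrow> g x \<le> (0::real)" for g and x :: 'a
    using linear_functional_attaining_norm[OF that, of 0 x] linear_0[OF that(1)] by simp
  have "f x y z w = 0" if "norm y \<le> 1" "norm z \<le> 1" "norm w \<le> 1" for x y z w
    by (rule lin0[OF lin1]) (rule assms that | assumption)+
  then have "f x y z w = 0" if "norm z \<le> 1" "norm w \<le> 1" for x y z w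
    using that by (intro lin0[OF lin2]) simp
  then have "f x y z w = 0" if "norm w \<le> 1" for x y z w
    using that by (intro lin0[OF lin3]) simp
  then show ?thesis
    by (intro lin0[OF lin4]) simp
qed

lemma simple_formI:
  fixes F :: "'a::euclidean_space list \<Rightarrow> real"
  assumes F: "F \<in> forms 4"
    and eq: "\<And>x y z w. F [x, y, z, w] = L * det4 (\<lambda>i. [a, b, c, d] ! i \<bullet> x) (\<lambda>i. [a, b, c, d] ! i \<bullet> y)
     (\<lambda>i. [a, b, c, d] ! i \<bullet> z) (\<lambda>i. [a, b, c, d] ! i \<bullet> w)"
  shows "simple_form 4 F"
proof -
  \<comment> \<open>The scalar \<open>L\<close> is absorbed into the first covector.\<close>
  let ?\<alpha>s = "[L *\<^sub>R flat a, flat b, flat c, flat d]"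
  have "F vs = wedge_list ?\<alpha>s vs" for vs
  proof (cases "length vs = 4")
    case True
    then obtain x y z w where "vs = [x, y, z, w]" by (auto simp: length_Suc_conv eval_nat_numeral)
    then show ?thesis
      by (simp add: eq wedge_list_4 det4_def minor_def blinfun.scaleR_left algebra_simps)
  next
    case False
    then show ?thesis using F by (simp add: wedge_list_eq_0 forms_def)
  qed
  then show ?thesis unfolding simple_form_def by (intro exI[of _ ?\<alpha>s]) auto
qed

lemma simple_form_of_fundamental_identity:
  fixes F :: "'a::euclidean_space list \<Rightarrow> real"
  assumes dim: "DIM('a) < 8" and F: "F \<in> forms 4"
    and act: "\<And>X Y. act (\<lambda>us. F (X # Y # us)) F = (\<lambda>_. 0)"
  shows "simple_form 4 F"
proof -
  interpret alternating4 "\<lambda>x y z w. F [x, y, z, w]" by (rule forms_alternating4[OF F])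
  have F2: "(\<lambda>us. F (X # Y # us)) \<in> forms 2" for X Y
    using interior_forms[of "\<lambda>us. F (X # us)" 2 Y] interior_forms[of F 3 X] F by simp
  obtain e1 e2 e3 e4 where norm: "norm e1 \<le> 1" "norm e2 \<le> 1" "norm e3 \<le> 1" "norm e4 \<le> 1"
    and max: "\<And>x y z w. norm x \<le> 1 \<Longrightarrow> norm y \<le> 1 \<Longrightarrow> norm z \<le> 1 \<Longrightarrow> norm w \<le> 1
      \<Longrightarrow> F [x, y, z, w] \<le> F [e1, e2, e3, e4]"
    using bounded_max by blast
  define L where "L = F [e1, e2, e3, e4]"
  show ?thesis
  proof (cases "L = 0")
    case True
    then have "F [x, y, z, w] = 0" for x y z w
      using max by (intro eq_0_of_max_0) (simp add: L_def)
    then show ?thesis by (intro simple_formI[OF F, of 0]) simp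
  next
    case False
    \<comment> \<open>With three arguments held at the maximizer, \<open>F\<close> is a linear
      functional attaining its bound at the fourth.\<close>
    have cal: "F [x, e2, e3, e4] = L * (e1 \<bullet> x)" "F [e1, x, e3, e4] = L * (e2 \<bullet> x)"
      "F [e1, e2, x, e4] = L * (e3 \<bullet> x)" "F [e1, e2, e3, x] = L * (e4 \<bullet> x)" for x
      by (rule linear_functional_attaining_norm[OF lin1] linear_functional_attaining_norm[OF lin2]
          linear_functional_attaining_norm[OF lin3] linear_functional_attaining_norm[OF lin4];
        simp add: L_def max norm)+
    have unit: "e1 \<bullet> e1 = 1" "e2 \<bullet> e2 = 1" "e3 \<bullet> e3 = 1" "e4 \<bullet> e4 = 1"
      using cal(1)[of e1] cal(2)[of e2] cal(3)[of e3] cal(4)[of e4] False by (simp_all flip: L_def)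
    have orth: "e1 \<bullet> e2 = 0" "e1 \<bullet> e3 = 0" "e1 \<bullet> e4 = 0" "e2 \<bullet> e3 = 0" "e2 \<bullet> e4 = 0" "e3 \<bullet> e4 = 0"
      using cal(1)[of e2] cal(1)[of e3] cal(1)[of e4] cal(2)[of e3] cal(2)[of e4] cal(3)[of e4] False
      by (simp_all add: f_repeat)
    then have ne: "e1 \<noteq> e2" "e1 \<noteq> e3" "e1 \<noteq> e4" "e2 \<noteq> e3" "e2 \<noteq> e4" "e3 \<noteq> e4"
      using unit by auto
    have "pairwise orthogonal {e1, e2, e3, e4}"
      using orth by (auto simp: pairwise_def orthogonal_def inner_commute)
    moreover have "card {e1, e2, e3, e4} = 4" using ne by simp
    moreover have "0 \<notin> {e1, e2, e3, e4}" using unit by auto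
    ultimately obtain u1 u2 u3 where u: "span ({e1, e2, e3, e4} \<union> {u1, u2, u3}) = UNIV"
      "\<And>e u. e \<in> {e1, e2, e3, e4} \<Longrightarrow> u \<in> {u1, u2, u3} \<Longrightarrow> e \<bullet> u = 0"
      "\<And>x. (\<And>e. e \<in> {e1, e2, e3, e4} \<Longrightarrow> e \<bullet> x = 0)
        \<Longrightarrow> x = (x \<bullet> u1) *\<^sub>R u1 + (x \<bullet> u2) *\<^sub>R u2 + (x \<bullet> u3) *\<^sub>R u3"
      using orthonormal_complement_frame[OF dim, of e1 e2 e3 e4] by blast
    interpret calibrated4 "\<lambda>x y z w. F [x, y, z, w]" e1 e2 e3 e4 u1 u2 u3 L
    proof
      show "F [br x y a, b, c, d] + F [a, br x y b, c, d] + F [a, b, br x y c, d] + F [a, b, c, br x y d] = 0"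
        for x y a b c d
        using act_eq_derivation[OF F2 F, of x y a b c d] act[of x y] by (simp add: br_def)
      show "L \<noteq> 0" by (rule False)
      show "e \<bullet> e = 1" if "e \<in> {e1, e2, e3, e4}" for e using that unit by blast
    qed (rule cal u; assumption)+
    show ?thesis by (rule simple_formI[OF F f_eq_det4])
  qed
qed

section \<open>From simplicity to the vanishing of the action\<close>

lemma simple_form_act_eq_0:
  fixes F :: "'a::euclidean_space list \<Rightarrow> real"
  assumes F: "F \<in> forms 4" and "simple_form 4 F"
  shows "act (\<lambda>us. F (X # Y # us)) F vs = 0"
proof (cases "length vs = 4")
  case True
  then obtain a b c d where vs: "vs = [a, b, c, d]" by (auto simp: length_Suc_conv eval_nat_numeral)
  interpret alternating4 "\<lambda>x y z w. F [x, y, z, w]" by (rule forms_alternating4[OF F])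
  have F2: "(\<lambda>us. F (X # Y # us)) \<in> forms 2"
    using interior_forms[of "\<lambda>us. F (X # us)" 2 Y] interior_forms[of F 3 X] F by simp
  obtain \<alpha>s where \<alpha>s: "length \<alpha>s = 4" "F = wedge_list \<alpha>s"
    using assms(2) unfolding simple_form_def by blast
  define k where "k x i = blinfun_apply (\<alpha>s ! i) x" for x i
  define s where "s i = sharp (\<alpha>s ! i)" for i
  define p where "p i j = minor i j (k X) (k Y)" for i j
  have F_det: "F [x, y, z, w] = det4 (k x) (k y) (k z) (k w)" for x y z w
    unfolding \<alpha>s(2) wedge_list_4[OF \<alpha>s(1)] k_def ..
  \<comment> \<open>\<open>M i l\<close> is the coefficient of \<open>k v l\<close> in F(X, Y, v, s
    i): the Gram matrix \<open>k (s i) j\<close> of the covectors times the skew matrix of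
    complementary minors of \<open>X\<close> and \<open>Y\<close>.\<close>
  define M where "M i l = [p 2 3 * k (s i) 1 - p 1 3 * k (s i) 2 + p 1 2 * k (s i) 3,
      - p 2 3 * k (s i) 0 + p 0 3 * k (s i) 2 - p 0 2 * k (s i) 3,
      p 1 3 * k (s i) 0 - p 0 3 * k (s i) 1 + p 0 1 * k (s i) 3,
      - p 1 2 * k (s i) 0 + p 0 2 * k (s i) 1 - p 0 1 * k (s i) 2] ! l" for i l
  define T where "T = br X Y"
  have k_T: "k (T v) = (\<lambda>i. M i 0 * k v 0 + M i 1 * k v 1 + M i 2 * k v 2 + M i 3 * k v 3)" for v
  proof
    fix i
    have "k (T v) i = T v \<bullet> s i"
      unfolding k_def s_def sharp_inner[symmetric] by (rule inner_commute)
    also have "\<dots> = F [X, Y, v, s i]"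
      unfolding T_def by (rule br_inner)
    also have "\<dots> = det4 (k X) (k Y) (k v) (k (s i))"
      by (rule F_det)
    finally show "k (T v) i = M i 0 * k v 0 + M i 1 * k v 1 + M i 2 * k v 2 + M i 3 * k v 3"
      unfolding det4_def p_def[symmetric] by (simp add: M_def minor_def algebra_simps)
  qed
  have sym: "k (s j) i = k (s i) j" for i j
    unfolding k_def s_def sharp_inner[symmetric] by (rule inner_commute)
  \<comment> \<open>The trace of a symmetric matrix times a skew one is zero.\<close>
  have "M 0 0 + M 1 1 + M 2 2 + M 3 3 = 0"
    unfolding M_def sym[of 1 0] sym[of 2 0] sym[of 3 0] sym[of 2 1] sym[of 3 1] sym[of 3 2] by simp
  then have "F [T a, b, c, d] + F [a, T b, c, d] + F [a, b, T c, d] + F [a, b, c, T d] = 0"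
    unfolding F_det k_T det4_derivation by simp
  then show ?thesis
    unfolding vs act_eq_derivation[OF F2 F] by (simp add: T_def br_def)
qed (simp add: act_eq_0[OF F])

theorem mainTheorem7:
  fixes F :: "'a::euclidean_space list \<Rightarrow> real"
  assumes "4 \<le> DIM('a)" and "DIM('a) < 8"
    and "F \<in> forms 4"
  shows "(\<forall>\<Xi> \<in> (forms 2 :: (('a \<Rightarrow>\<^sub>L real) list \<Rightarrow> real) set). act (contract \<Xi> F) F = (\<lambda>_. 0))
    \<longleftrightarrow> simple_form 4 F"
proof
  assume *: "\<forall>\<Xi> \<in> (forms 2 :: (('a \<Rightarrow>\<^sub>L real) list \<Rightarrow> real) set). act (contract \<Xi> F) F = (\<lambda>_. 0)"
  \<comment> \<open>Specialize to the decomposable bivector of \<open>X\<close> and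
    \<open>Y\<close>.\<close>
  have "act (\<lambda>us. F (X # Y # us)) F = (\<lambda>_. 0)" for X Y
  proof -
    have "contract (wedge_vec X Y) F = (\<lambda>us. F (X # Y # us))"
      by (rule ext) (rule contract_decomposable[OF assms(3)])
    then show ?thesis using * wedge_vec_forms[of X Y] by metis
  qed
  then show "simple_form 4 F"
    by (rule simple_form_of_fundamental_identity[OF assms(2,3)])
next
  assume "simple_form 4 F"
  then show "\<forall>\<Xi> \<in> (forms 2 :: (('a \<Rightarrow>\<^sub>L real) list \<Rightarrow> real) set). act (contract \<Xi> F) F = (\<lambda>_. 0)"
    using simple_form_act_eq_0[OF assms(3)] act_contract_eq_0 by blast
qed

end
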